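(* Let $n\geq 1$ be an integer, let $D\subset\mathbb{C}^n$ be an open subset, and let $f:=f_1+if_2:D\to\mathbb{C}$ be a holomorphic function, where $f_1,f_2:D\to\mathbb{R}$ are the real and imaginary parts of $f$. If $f_1$ is a real Nash function on $D$ (with $D$ regarded as an open subset of $\mathbb{R}^{2n}$), then $f$ is a complex Nash function on $D$.
   Context: Let $k$ be either $\mathbb{R}$ or $\mathbb{C}$, let $D\subset k^m$ be a (non-empty) open subset and $g:D\to k$ a function. The function $g$ is a $k$-Nash function at $x_0\in D$ if there exist an open neighbourhood $U$ of $x_0$ in $D$ and a non-zero polynomial $P\in k[x_1,\ldots,x_m,t]$ such that $g$ is $k$-analytic on $U$ (real analytic if $k=\mathbb{R}$, holomorphic if $k=\mathbb{C}$) and $P(x,g(x))=0$ for each $x\in U$. The function $g$ is a $k$-Nash function on $D$ if it is $k$-Nash at every point of $D$. $\mathbb{R}$-Nash functions are called real Nash functions and $\mathbb{C}$-Nash functions are called complex Nash functions. Note that the polynomial $P$ may depend on the point $x_0$, and $D$ is not assumed connected. $\mathbb{C}^n$ is identified with $\mathbb{R}^{2n}$ by $z=x+iy$, $x=(x_1,\ldots,x_n)$, $y=(y_1,\ldots,y_n)\in\mathbb{R}^n$. Thus $D\subset\mathbb{C}^n$ is also regarded as the open set $\{(x,y)\in\mathbb{R}^{2n}: x+iy\in D\}$, and the real-valued functions $f_1,f_2$ on $D$ are regarded as the functions $(x,y)\mapsto f_1(x+iy)$ and $(x,y)\mapsto f_2(x+iy)$ of $2n$ real variables. To say that $f_1$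 or $f_2$ is a real Nash function on $D$ means that it is so as a function of these $2n$ real variables. *)

theory Defs
  imports "HOL-Analysis.Analysis" "HOL-Library.Poly_Mapping"
begin

text \<open>
  A polynomial with coefficients in \<open>'k\<close> and variables indexed by \<open>'v\<close> is a finitely supported
  map from exponent vectors to coefficients. The type \<open>'m option\<close> indexes the variables
  \<open>x\<^sub>1, \<dots>, x\<^sub>m, t\<close>, with \<open>None\<close> standing for \<open>t\<close>.
\<close>

definition poly_eval ::
    "(('v::finite \<Rightarrow>\<^sub>0 nat) \<Rightarrow>\<^sub>0 'k::comm_semiring_1) \<Rightarrow> ('v \<Rightarrow> 'k) \<Rightarrow> 'k" where
  "poly_eval P x =
     (\<Sum>\<alpha>\<in>Poly_Mapping.keys P. Poly_Mapping.lookup P \<alpha> * (\<Prod>v\<in>UNIV. x v ^ Poly_Mapping.lookup \<alpha> v))"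

text \<open>
  Local expansion into a power series over all multi-indices. The inclusion of the ball in \<open>U\<close>
  makes the predicate independent of the values of \<open>g\<close> outside \<open>U\<close>.
\<close>

definition real_analytic_on :: "(real ^ 'm \<Rightarrow> real) \<Rightarrow> (real ^ 'm) set \<Rightarrow> bool" where
  "real_analytic_on g U \<longleftrightarrow>
     (\<forall>a\<in>U. \<exists>r>0. \<exists>c :: ('m \<Rightarrow> nat) \<Rightarrow> real. ball a r \<subseteq> U \<and>
        (\<forall>x\<in>ball a r. ((\<lambda>\<alpha>. c \<alpha> * (\<Prod>i\<in>UNIV. (x $ i - a $ i) ^ \<alpha> i)) has_sum g x) UNIV))"

text \<open>
  Holomorphy in several variables on an open set: the real Frechet derivative exists at every
  point and is complex linear. The library's \<open>holomorphic_on\<close> covers only one variable.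
\<close>

definition several_holomorphic_on :: "(complex ^ 'm \<Rightarrow> complex) \<Rightarrow> (complex ^ 'm) set \<Rightarrow> bool" where
  "several_holomorphic_on g U \<longleftrightarrow>
     (\<forall>z\<in>U. \<exists>L. (g has_derivative L) (at z) \<and> (\<forall>c v. L (c *s v) = c * L v))"

text \<open>The parameter \<open>analytic\<close> is the notion of analyticity belonging to the field \<open>'k\<close>.\<close>

definition nash_at ::
    "(('k ^ 'm \<Rightarrow> 'k) \<Rightarrow> ('k ^ 'm) set \<Rightarrow> bool) \<Rightarrow>
     ('k ^ 'm \<Rightarrow> 'k::real_normed_field) \<Rightarrow> ('k ^ 'm) set \<Rightarrow> 'k ^ 'm \<Rightarrow> bool" where
  "nash_at analytic g D x0 \<longleftrightarrow>
     (\<exists>U. \<exists>P :: ('m option \<Rightarrow>\<^sub>0 nat) \<Rightarrow>\<^sub>0 'k.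
        open U \<and> x0 \<in> U \<and> U \<subseteq> D \<and> P \<noteq> 0 \<and> analytic g U \<and>
        (\<forall>x\<in>U. poly_eval P (case_option (g x) (\<lambda>i. x $ i)) = 0))"

definition real_nash_on :: "(real ^ 'm \<Rightarrow> real) \<Rightarrow> (real ^ 'm) set \<Rightarrow> bool" where
  "real_nash_on g D \<longleftrightarrow> (\<forall>x\<in>D. nash_at real_analytic_on g D x)"

definition complex_nash_on :: "(complex ^ 'm \<Rightarrow> complex) \<Rightarrow> (complex ^ 'm) set \<Rightarrow> bool" where
  "complex_nash_on g D \<longleftrightarrow> (\<forall>z\<in>D. nash_at several_holomorphic_on g D z)"

text \<open>
  The identification of \<open>\<real>\<^sup>2\<^sup>n\<close> with \<open>\<complex>\<^sup>n\<close> by \<open>(x, y) \<mapsto> x + iy\<close>: the index type \<open>'n + 'n\<close> has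
  \<open>2n\<close> elements, with \<open>Inl j\<close> the index of \<open>x\<^sub>j\<close> and \<open>Inr j\<close> that of \<open>y\<^sub>j\<close>.
\<close>

definition complex_of_real_pair :: "real ^ ('n + 'n) \<Rightarrow> complex ^ 'n" where
  "complex_of_real_pair p = (\<chi> j. Complex (p $ Inl j) (p $ Inr j))"

end

theory Submission
  imports Defs "HOL-Complex_Analysis.Conformal_Mappings"
begin

text \<open>
  Polarization: near \<open>(x\<^sub>0, y\<^sub>0)\<close> the relation \<open>P (x, y, f\<^sub>1 (x + iy)) = 0\<close> extends holomorphically to
  \<open>P ((z + cnj w) / 2, (z - cnj w) / 2i, (f z + cnj (f w)) / 2) = 0\<close> for independent \<open>z\<close> and \<open>w\<close>,
  since a pair \<open>(z, w)\<close> lies on a complex line whose real points satisfy \<open>z = w\<close>. Freezing \<open>w\<close>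
  turns this into a polynomial relation between \<open>z\<close> and \<open>f z\<close>. It is nontrivial for a suitable \<open>w\<close>
  because \<open>P\<close>, being nonzero, does not vanish at some real point \<open>(Re w, Im w, t)\<close> with \<open>w\<close>
  close to \<open>z\<^sub>0\<close>.
\<close>

section \<open>Polynomial functions\<close>

lemma poly_eval_superset:
  assumes "finite A" "Poly_Mapping.keys P \<subseteq> A"
  shows "poly_eval P x = (\<Sum>\<alpha>\<in>A. Poly_Mapping.lookup P \<alpha> * (\<Prod>v\<in>UNIV. x v ^ Poly_Mapping.lookup \<alpha> v))"
  unfolding poly_eval_def using assms
  by (intro sum.mono_neutral_left) (auto simp: in_keys_iff)

lemma poly_eval_zero [simp]: "poly_eval 0 x = 0"
  by (simp add: poly_eval_def)

lemma poly_eval_single: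
  "poly_eval (Poly_Mapping.single \<alpha> c) x = c * (\<Prod>v\<in>UNIV. x v ^ Poly_Mapping.lookup \<alpha> v)"
  by (subst poly_eval_superset[of "{\<alpha>}"]) auto

lemma poly_eval_add: "poly_eval (P + Q) x = poly_eval P x + poly_eval Q x"
proof -
  let ?A = "Poly_Mapping.keys P \<union> Poly_Mapping.keys Q"
  have "Poly_Mapping.keys (P + Q) \<subseteq> ?A" by (rule keys_add)
  then show ?thesis
    by (simp add: poly_eval_superset[of ?A] lookup_add distrib_right sum.distrib)
qed

lemma poly_mapping_add_single_induct [case_names zero add]:
  assumes "R 0" "\<And>P \<alpha> c. R P \<Longrightarrow> R (Poly_Mapping.single \<alpha> c + P)"
  shows "R P"
proof (induction P rule: update_induct)
  case const
  then show ?case by (fact assms)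
next
  case (update P \<alpha> c)
  \<comment> \<open>The induction rule only overwrites at an exponent outside the support, where
    overwriting amounts to adding.\<close>
  have "Poly_Mapping.update \<alpha> c P = Poly_Mapping.single \<alpha> c + P"
    using update(1)
    by (intro poly_mapping_eqI) (auto simp: lookup_update lookup_add lookup_single in_keys_iff)
  then show ?case using update assms by simp
qed

lemma poly_eval_single_mult:
  "poly_eval (Poly_Mapping.single \<alpha> c * Q) x = poly_eval (Poly_Mapping.single \<alpha> c) x * poly_eval Q x"
  by (induction Q rule: poly_mapping_add_single_induct)
     (simp_all add: distrib_left poly_eval_add mult_single poly_eval_single lookup_add power_add
       prod.distrib mult_ac)

lemma poly_eval_mult: "poly_eval (P * Q) x = poly_eval P x * poly_eval Q x"
  by (induction P rule: poly_mapping_add_single_induct)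
     (simp_all add: distrib_right poly_eval_add poly_eval_single_mult)

text \<open>Working with functions lets the final polynomial relation come from closure properties,
  without computing coefficients of a substitution.\<close>

definition polynomial_fun :: "(('v::finite \<Rightarrow> 'k::comm_semiring_1) \<Rightarrow> 'k) \<Rightarrow> bool" where
  "polynomial_fun g \<longleftrightarrow> (\<exists>Q. \<forall>x. poly_eval Q x = g x)"

lemma polynomial_fun_const: "polynomial_fun (\<lambda>x. c)"
  unfolding polynomial_fun_def
  by (rule exI[of _ "Poly_Mapping.single 0 c"]) (simp add: poly_eval_single)

lemma polynomial_fun_var: "polynomial_fun (\<lambda>x. x v)"
proof -
  have "(\<Prod>u\<in>UNIV. x u ^ Poly_Mapping.lookup (Poly_Mapping.single v 1) u) = x v" for x :: "'a \<Rightarrow> 'b"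
  proof -
    have "(\<Prod>u\<in>UNIV. x u ^ Poly_Mapping.lookup (Poly_Mapping.single v 1) u) = (\<Prod>u\<in>UNIV. if u = v then x u else 1)"
      by (intro prod.cong) (auto simp: lookup_single)
    then show ?thesis by simp
  qed
  then show ?thesis
    unfolding polynomial_fun_def
    by (intro exI[of _ "Poly_Mapping.single (Poly_Mapping.single v 1) 1"])
       (simp add: poly_eval_single)
qed

lemma polynomial_fun_add:
  "polynomial_fun g \<Longrightarrow> polynomial_fun h \<Longrightarrow> polynomial_fun (\<lambda>x. g x + h x)"
  unfolding polynomial_fun_def by (metis poly_eval_add)

lemma polynomial_fun_mult:
  "polynomial_fun g \<Longrightarrow> polynomial_fun h \<Longrightarrow> polynomial_fun (\<lambda>x. g x * h x)"
  unfolding polynomial_fun_def by (metis poly_eval_mult)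

lemma polynomial_fun_affine: "polynomial_fun (\<lambda>x. (x v + b) / (a :: 'k :: field))"
  unfolding divide_inverse
  by (intro polynomial_fun_mult polynomial_fun_add polynomial_fun_var polynomial_fun_const)

lemma polynomial_fun_power: "polynomial_fun g \<Longrightarrow> polynomial_fun (\<lambda>x. g x ^ n)"
  by (induction n) (auto intro: polynomial_fun_const polynomial_fun_mult)

lemma polynomial_fun_sum:
  "(\<And>i. i \<in> A \<Longrightarrow> polynomial_fun (g i)) \<Longrightarrow> polynomial_fun (\<lambda>x. \<Sum>i\<in>A. g i x)"
  by (induction A rule: infinite_finite_induct) (auto intro: polynomial_fun_const polynomial_fun_add)

lemma polynomial_fun_prod:
  "(\<And>i. i \<in> A \<Longrightarrow> polynomial_fun (g i)) \<Longrightarrow> polynomial_fun (\<lambda>x. \<Prod>i\<in>A. g i x)"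
  by (induction A rule: infinite_finite_induct) (auto intro: polynomial_fun_const polynomial_fun_mult)

lemma polynomial_fun_poly_eval:
  "(\<And>v. polynomial_fun (g v)) \<Longrightarrow> polynomial_fun (\<lambda>x. poly_eval P (\<lambda>v. g v x))"
  unfolding poly_eval_def
  by (intro polynomial_fun_sum polynomial_fun_mult polynomial_fun_const polynomial_fun_prod
      polynomial_fun_power)

lemma holomorphic_on_poly_eval:
  "(\<And>v. (\<lambda>s. g s v) holomorphic_on S) \<Longrightarrow> (\<lambda>s. poly_eval P (g s)) holomorphic_on S"
  unfolding poly_eval_def by (intro holomorphic_intros)

section \<open>Nonvanishing of polynomials on infinite grids\<close>

text \<open>Induction on the variables, reducing to the finiteness of the roots of a polynomial in
  one variable. Exponents are functions on the whole type \<open>'v\<close>, so injectivity of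
  restriction to \<open>V\<close> is what makes them distinct monomials in the variables from
  \<open>V\<close>.\<close>

lemma monomials_independent_on_grid:
  fixes c :: "('v \<Rightarrow> nat) \<Rightarrow> 'k::{idom,real_normed_div_algebra}"
  assumes "finite V" "\<And>v. v \<in> V \<Longrightarrow> infinite (S v)" "finite A"
    and "inj_on (\<lambda>\<alpha>. restrict \<alpha> V) A"
    and "\<And>x. (\<And>v. v \<in> V \<Longrightarrow> x v \<in> S v) \<Longrightarrow> (\<Sum>\<alpha>\<in>A. c \<alpha> * (\<Prod>v\<in>V. x v ^ \<alpha> v)) = 0"
    and "\<alpha> \<in> A"
  shows "c \<alpha> = 0"
  using assms
proof (induction V arbitrary: A \<alpha> rule: finite_induct)
  case empty
  \<comment> \<open>All restrictions to the empty set coincide, so injectivity leaves a single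
    exponent and the sum is \<open>c \<alpha>\<close> itself.\<close>
  then have "A = {\<alpha>}" by (auto simp: inj_on_def restrict_def)
  then show ?case using empty.prems(4) by simp
next
  case (insert u V)
  define B where "B k = {\<beta>\<in>A. \<beta> u = k}" for k
  define N where "N = Max ((\<lambda>\<beta>. \<beta> u) ` A)"
  have N: "\<beta> u \<le> N" if "\<beta> \<in> A" for \<beta>
    unfolding N_def using insert.prems that by (intro Max_ge) auto
  \<comment> \<open>With \<open>x\<close> fixed on \<open>V\<close>, the full sum is a polynomial in
    \<open>t\<close>, the value at \<open>u\<close>, whose coefficients are the sums over the slices
    \<open>B k\<close>. It vanishes on the infinite set \<open>S u\<close>, so its coefficient at
    \<open>\<alpha> u\<close> cannot be nonzero.\<close>
  have "(\<Sum>\<beta>\<in>B (\<alpha> u). c \<beta> * (\<Prod>v\<in>V. x v ^ \<beta> v)) = 0" if x: "\<And>v. v \<in> V \<Longrightarrow> x v \<in> S v" for x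
  proof (rule ccontr)
    assume nz: "(\<Sum>\<beta>\<in>B (\<alpha> u). c \<beta> * (\<Prod>v\<in>V. x v ^ \<beta> v)) \<noteq> 0"
    define d where "d k = (\<Sum>\<beta>\<in>B k. c \<beta> * (\<Prod>v\<in>V. x v ^ \<beta> v))" for k
    have "(\<Sum>k\<le>N. d k * t ^ k) = 0" if t: "t \<in> S u" for t
    proof -
      have "(\<Sum>k\<le>N. d k * t ^ k) = (\<Sum>k\<le>N. \<Sum>\<beta>\<in>B k. c \<beta> * (\<Prod>v\<in>V. x v ^ \<beta> v) * t ^ \<beta> u)"
        by (auto simp: d_def sum_distrib_right B_def intro!: sum.cong)
      also have "\<dots> = (\<Sum>\<beta>\<in>A. c \<beta> * (\<Prod>v\<in>V. x v ^ \<beta> v) * t ^ \<beta> u)"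
        unfolding B_def by (rule sum.group) (use insert.prems N in auto)
      also have "\<dots> = (\<Sum>\<beta>\<in>A. c \<beta> * (\<Prod>v\<in>insert u V. (x(u := t)) v ^ \<beta> v))"
      proof (intro sum.cong refl)
        fix \<beta>
        have "(\<Prod>v\<in>V. (x(u := t)) v ^ \<beta> v) = (\<Prod>v\<in>V. x v ^ \<beta> v)"
          using insert.hyps by (intro prod.cong) auto
        then show "c \<beta> * (\<Prod>v\<in>V. x v ^ \<beta> v) * t ^ \<beta> u =
            c \<beta> * (\<Prod>v\<in>insert u V. (x(u := t)) v ^ \<beta> v)"
          using insert.hyps by (simp add: mult_ac)
      qed
      also have "\<dots> = 0"
        using x t by (intro insert.prems(4)) auto
      finally show ?thesis .
    qed
    then have "S u \<subseteq> {t. (\<Sum>k\<le>N. d k * t ^ k) = 0}" by auto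
    moreover have "finite {t. (\<Sum>k\<le>N. d k * t ^ k) = 0}"
      using nz N[OF insert.prems(5)] polyfun_finite_roots[of d N] by (auto simp: d_def)
    ultimately show False
      using insert.prems(1)[of u] finite_subset by blast
  qed
  \<comment> \<open>Exponents in one slice agree at \<open>u\<close>, so dropping \<open>u\<close>
    cannot identify two of them.\<close>
  moreover have "inj_on (\<lambda>\<beta>. restrict \<beta> V) (B (\<alpha> u))"
  proof (rule inj_onI)
    fix \<beta> \<gamma> assume *: "\<beta> \<in> B (\<alpha> u)" "\<gamma> \<in> B (\<alpha> u)" "restrict \<beta> V = restrict \<gamma> V"
    then have "restrict \<beta> (insert u V) = restrict \<gamma> (insert u V)"
      by (auto simp: B_def restrict_def fun_eq_iff) metis
    then show "\<beta> = \<gamma>"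
      using * inj_onD[OF insert.prems(3), of \<beta> \<gamma>] by (simp add: B_def)
  qed
  moreover have "finite (B (\<alpha> u))" "\<alpha> \<in> B (\<alpha> u)"
    using insert.prems by (auto simp: B_def)
  moreover have "\<And>v. v \<in> V \<Longrightarrow> infinite (S v)"
    using insert.prems(1) by blast
  ultimately show ?case
    using insert.IH[of "B (\<alpha> u)" \<alpha>] by blast
qed

text \<open>The grid allows the nonvanishing point to be sought near a given one in the space
  coordinates, with the coordinate \<open>t\<close> left free.\<close>

lemma poly_eval_nonzero_on_grid:
  fixes P :: "('v::finite \<Rightarrow>\<^sub>0 nat) \<Rightarrow>\<^sub>0 'k::{idom,real_normed_div_algebra}"
  assumes "P \<noteq> 0" "\<And>v. infinite (S v)"
  obtains x where "\<And>v. x v \<in> S v" "poly_eval P x \<noteq> 0"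
proof (rule ccontr)
  assume "\<not> thesis"
  then have zero: "poly_eval P x = 0" if "\<And>v. x v \<in> S v" for x
    using that \<open>\<And>x. (\<And>v. x v \<in> S v) \<Longrightarrow> poly_eval P x \<noteq> 0 \<Longrightarrow> thesis\<close> by blast
  have inj: "inj_on Poly_Mapping.lookup (Poly_Mapping.keys P)"
    by (auto intro: inj_onI poly_mapping_eqI)
  obtain \<alpha> where \<alpha>: "\<alpha> \<in> Poly_Mapping.keys P"
    using \<open>P \<noteq> 0\<close> keys_eq_empty by blast
  \<comment> \<open>The independence lemma takes plain functions as exponents; inverting
    \<open>lookup\<close> on the support carries the coefficients over to them.\<close>
  have "Poly_Mapping.lookup P (the_inv_into (Poly_Mapping.keys P) Poly_Mapping.lookup (Poly_Mapping.lookup \<alpha>)) = 0"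
  proof (rule monomials_independent_on_grid
      [of UNIV S "Poly_Mapping.lookup ` Poly_Mapping.keys P" "\<lambda>\<beta>. Poly_Mapping.lookup P (the_inv_into (Poly_Mapping.keys P) Poly_Mapping.lookup \<beta>)"])
    fix x assume "\<And>v. v \<in> UNIV \<Longrightarrow> x v \<in> S v"
    then have "poly_eval P x = 0" by (intro zero) auto
    then show "(\<Sum>\<beta>\<in>Poly_Mapping.lookup ` Poly_Mapping.keys P. Poly_Mapping.lookup P (the_inv_into (Poly_Mapping.keys P) Poly_Mapping.lookup \<beta>) *
        (\<Prod>v\<in>UNIV. x v ^ \<beta> v)) = 0"
      by (simp add: sum.reindex[OF inj] poly_eval_def the_inv_into_f_f[OF inj])
  next
    show "inj_on (\<lambda>\<alpha>. restrict \<alpha> UNIV) (Poly_Mapping.lookup ` Poly_Mapping.keys P)"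
      by (simp add: restrict_UNIV)
  qed (use assms \<alpha> in auto)
  then show False using \<alpha> by (simp add: the_inv_into_f_f[OF inj] in_keys_iff)
qed

section \<open>Extension of scalars from the reals to the complex numbers\<close>

abbreviation complexify ::
    "(('v \<Rightarrow>\<^sub>0 nat) \<Rightarrow>\<^sub>0 real) \<Rightarrow> ('v \<Rightarrow>\<^sub>0 nat) \<Rightarrow>\<^sub>0 complex" where
  "complexify \<equiv> Poly_Mapping.map complex_of_real"

lemma poly_eval_complexify_of_real:
  "poly_eval (complexify P) (\<lambda>v. complex_of_real (x v)) = complex_of_real (poly_eval P x)"
proof -
  have lookup_complexify: "Poly_Mapping.lookup (complexify P) \<alpha> = complex_of_real (Poly_Mapping.lookup P \<alpha>)" for \<alpha>
    by (simp add: map.rep_eq when_def)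
  then have "Poly_Mapping.keys (complexify P) = Poly_Mapping.keys P"
    by (auto simp: in_keys_iff)
  then show ?thesis
    by (simp add: poly_eval_def lookup_complexify)
qed

section \<open>Polarization\<close>

lemma bounded_linear_vector_scalar_mult_left:
  "bounded_linear (\<lambda>s. s *s (B :: complex ^ 'n))"
  unfolding linear_conv_bounded_linear[symmetric]
  by (rule linearI) (auto simp: vec_eq_iff algebra_simps)

lemma holomorphic_on_complex_line:
  assumes "several_holomorphic_on f U" "\<And>s. s \<in> S \<Longrightarrow> A + s *s B \<in> U" "open S"
  shows "(\<lambda>s. f (A + s *s B)) holomorphic_on S"
  unfolding holomorphic_on_open[OF \<open>open S\<close>]
proof
  fix s assume "s \<in> S"
  then obtain L where L: "(f has_derivative L) (at (A + s *s B))" "\<And>c v. L (c *s v) = c * L v"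
    using assms unfolding several_holomorphic_on_def by blast
  have "((\<lambda>s. A + s *s B) has_derivative (\<lambda>h. h *s B)) (at s)"
    using bounded_linear.has_derivative[OF bounded_linear_vector_scalar_mult_left has_derivative_ident]
    by (auto intro!: derivative_eq_intros)
  from has_derivative_compose[OF this L(1)]
  show "\<exists>f'. ((\<lambda>s. f (A + s *s B)) has_field_derivative f') (at s)"
    by (auto simp: L(2) has_field_derivative_def mult.commute[of _ "L B"] intro!: exI[of _ "L B"])
qed

text \<open>Identity theorem: since \<open>S\<close> is open, its real points accumulate at
  \<open>x\<close>.\<close>

lemma holomorphic_zero_on_reals_imp_zero:
  assumes "h holomorphic_on S" "open S" "connected S" "complex_of_real x \<in> S"
    and zero: "\<And>t. complex_of_real t \<in> S \<Longrightarrow> h (of_real t) = 0"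
    and "s \<in> S"
  shows "h s = 0"
proof (rule analytic_continuation[OF assms(1-3) _ \<open>of_real x \<in> S\<close>, of "S \<inter> \<real>"])
  show "complex_of_real x islimpt S \<inter> \<real>"
    unfolding islimpt_approachable
  proof (intro allI impI)
    fix e :: real assume "e > 0"
    obtain d where d: "d > 0" "ball (complex_of_real x) d \<subseteq> S"
      using assms openE by blast
    define t where "t = x + min d e / 2"
    have "dist (complex_of_real t) (of_real x) = min d e / 2"
      using d \<open>e > 0\<close> by (simp add: t_def dist_norm)
    moreover from this have "complex_of_real t \<in> S" "t \<noteq> x"
      using d \<open>e > 0\<close> by (auto simp: t_def dist_commute intro!: subsetD[OF d(2)])
    ultimately show "\<exists>y\<in>S \<inter> \<real>. y \<noteq> complex_of_real x \<and> dist y (complex_of_real x) < e"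
      using d \<open>e > 0\<close> by (intro bexI[of _ "of_real t"]) auto
  qed
qed (use assms in \<open>auto elim!: Reals_cases\<close>)

text \<open>These are the formulas for the real and imaginary parts in terms of \<open>z\<close> and
  its conjugate, with the conjugate replaced by that of an independent \<open>w\<close>. For fixed
  \<open>w\<close> they are affine in \<open>z\<close>.\<close>

definition polarized_point :: "complex \<Rightarrow> complex ^ 'n \<Rightarrow> complex ^ 'n \<Rightarrow> ('n + 'n) option \<Rightarrow> complex" where
  "polarized_point t z w v = (case v of None \<Rightarrow> t
     | Some (Inl j) \<Rightarrow> (z $ j + cnj (w $ j)) / 2
     | Some (Inr j) \<Rightarrow> (z $ j - cnj (w $ j)) / (2 * \<i>))"

lemma polarized_point_diagonal:
  "polarized_point (complex_of_real t) z z =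
     (\<lambda>v. complex_of_real (case_option t (case_sum (\<lambda>j. Re (z $ j)) (\<lambda>j. Im (z $ j))) v))"
  by (auto simp: polarized_point_def fun_eq_iff complex_eq_iff split: option.split sum.split)

lemma polarization:
  fixes f :: "complex ^ 'n \<Rightarrow> complex"
  assumes hol: "several_holomorphic_on f (ball z0 r)"
    and P: "\<And>z. z \<in> ball z0 r \<Longrightarrow>
      poly_eval P (case_option (Re (f z)) (case_sum (\<lambda>j. Re (z $ j)) (\<lambda>j. Im (z $ j)))) = 0"
    and z: "z \<in> ball z0 r" and w: "w \<in> ball z0 r"
  shows "poly_eval (complexify P) (polarized_point ((f z + cnj (f w)) / 2) z w) = 0"
proof -
  \<comment> \<open>The line is chosen so that \<open>Z \<i> = z\<close> and \<open>Z (cnj \<i>) = w\<close>.\<close>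
  define A where "A = (1/2) *s (z + w)"
  define B where "B = (1 / (2 * \<i>)) *s (z - w)"
  define Z where "Z s = A + s *s B" for s
  define S where "S = Z -` ball z0 r"
  \<comment> \<open>Symmetry under conjugation keeps both \<open>Z s\<close> and
    \<open>Z (cnj s)\<close> in the ball.\<close>
  define S' where "S' = S \<inter> cnj -` S"
  \<comment> \<open>Conjugating both inside and outside \<open>f\<close> makes the second term
    holomorphic in \<open>s\<close>. For real \<open>s\<close> both points are \<open>Z s\<close>,
    so \<open>h s\<close> is a value of \<open>P\<close> at a real point; at \<open>\<i>\<close> it
    is the value to be shown zero.\<close>
  define h where "h s = poly_eval (complexify P)
      (polarized_point ((f (Z s) + cnj (f (Z (cnj s)))) / 2) (Z s) (Z (cnj s)))" for s
  have Zi: "Z \<i> = z" "Z (- \<i>) = w"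
    by (simp_all add: Z_def A_def B_def vec_eq_iff field_simps)
  have contZ: "continuous_on UNIV Z"
    unfolding Z_def
    by (intro continuous_intros bounded_linear.continuous_on[OF bounded_linear_vector_scalar_mult_left])
  have openS: "open S"
    unfolding S_def using contZ by (intro open_vimage) auto
  have openS': "open S'"
    unfolding S'_def by (intro open_Int openS open_vimage continuous_intros)
  have "convex S"
  proof -
    have "S = (\<lambda>s. s *s B) -` ((+) (- A) ` ball z0 r)"
      by (force simp: S_def Z_def image_iff)
    then show ?thesis
      by (auto intro!: convex_linear_vimage bounded_linear.linear
          bounded_linear_vector_scalar_mult_left convex_translation)
  qed
  then have convex: "convex S'"
    unfolding S'_def
    by (intro convex_Int convex_linear_vimage) (auto intro: bounded_linear.linear bounded_linear_cnj)
  have i: "\<i> \<in> S'" "- \<i> \<in> S'"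
    using z w by (auto simp: S'_def S_def Zi)
  \<comment> \<open>The identity theorem needs a real point of \<open>S'\<close>; convexity supplies
    the midpoint of \<open>\<i>\<close> and its conjugate.\<close>
  have "0 = (1/2) *\<^sub>R \<i> + (1/2) *\<^sub>R (- \<i>)" by simp
  then have zero: "complex_of_real 0 \<in> S'"
    using convexD[OF convex i, of "1/2" "1/2"] by simp
  have hol1: "(\<lambda>s. f (Z s)) holomorphic_on S"
    unfolding Z_def
    by (rule holomorphic_on_complex_line[OF hol _ openS]) (simp add: S_def Z_def)
  have "cnj \<circ> (\<lambda>s. f (Z s)) \<circ> cnj holomorphic_on cnj -` S"
    by (intro holomorphic_on_compose_cnj_cnj holomorphic_on_subset[OF hol1] open_vimage openS
        continuous_intros) auto
  then have hol2: "(\<lambda>s. cnj (f (Z (cnj s)))) holomorphic_on S'"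
    by (auto simp: o_def S'_def elim: holomorphic_on_subset)
  have hol1': "(\<lambda>s. f (Z s)) holomorphic_on S'"
    using hol1 by (rule holomorphic_on_subset) (auto simp: S'_def)
  have "h \<i> = 0"
  proof (rule holomorphic_zero_on_reals_imp_zero[OF _ openS' convex_connected[OF convex] zero _ i(1)])
    show "h holomorphic_on S'"
      unfolding h_def
    proof (rule holomorphic_on_poly_eval)
      fix v :: "('n + 'n) option"
      show "(\<lambda>s. polarized_point ((f (Z s) + cnj (f (Z (cnj s)))) / 2) (Z s) (Z (cnj s)) v)
          holomorphic_on S'"
      proof (cases v)
        case None
        then show ?thesis
          by (auto simp: polarized_point_def intro!: holomorphic_intros hol1' hol2)
      next
        case (Some k)
        then show ?thesis
          by (cases k) (auto simp: polarized_point_def Z_def intro!: holomorphic_intros)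
      qed
    qed
  next
    fix t assume "complex_of_real t \<in> S'"
    then have "Z (of_real t) \<in> ball z0 r" by (auto simp: S'_def S_def)
    moreover have "(f y + cnj (f y)) / 2 = of_real (Re (f y))" for y
      by (simp add: complex_eq_iff)
    ultimately show "h (of_real t) = 0"
      by (simp only: h_def complex_cnj_complex_of_real polarized_point_diagonal
          poly_eval_complexify_of_real P of_real_0)
  qed
  then show ?thesis by (simp add: h_def Zi)
qed

section \<open>Real coordinates on complex space, and the Nash property of \<open>f\<close>\<close>

lemma complex_of_real_pair_surj:
  "complex_of_real_pair (\<chi> k. case_sum (\<lambda>j. Re (z $ j)) (\<lambda>j. Im (z $ j)) k) = z"
  by (simp add: complex_of_real_pair_def vec_eq_iff)

lemma continuous_on_complex_of_real_pair: "continuous_on UNIV complex_of_real_pair"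
  unfolding complex_of_real_pair_def Complex_eq
  by (intro continuous_on_vec_lambda continuous_intros)

lemma continuous_on_real_pair_of_complex:
  "continuous_on UNIV (\<lambda>z :: complex ^ 'n. \<chi> k. case_sum (\<lambda>j. Re (z $ j)) (\<lambda>j. Im (z $ j)) k)"
proof (rule continuous_on_vec_lambda)
  show "continuous_on UNIV (\<lambda>z :: complex ^ 'n. case_sum (\<lambda>j. Re (z $ j)) (\<lambda>j. Im (z $ j)) k)" for k
    by (cases k) (auto intro!: continuous_intros)
qed

theorem theorem1p3:
  fixes D :: "(complex ^ 'n) set"
    and f :: "complex ^ 'n \<Rightarrow> complex"
    and f1 f2 :: "complex ^ 'n \<Rightarrow> real"
  assumes "open D"
    and "\<And>z. z \<in> D \<Longrightarrow> f z = complex_of_real (f1 z) + \<i> * complex_of_real (f2 z)"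
    and "several_holomorphic_on f D"
    and "real_nash_on (\<lambda>p. f1 (complex_of_real_pair p)) {p. complex_of_real_pair p \<in> D}"
  shows "complex_nash_on f D"
  unfolding complex_nash_on_def
proof
  fix z0 assume "z0 \<in> D"
  define \<rho> where "\<rho> z = (\<chi> k. case_sum (\<lambda>j. Re (z $ j)) (\<lambda>j. Im (z $ j)) k)" for z :: "complex ^ 'n"
  have \<rho>: "complex_of_real_pair (\<rho> z) = z" for z
    unfolding \<rho>_def by (rule complex_of_real_pair_surj)
  have "nash_at real_analytic_on (\<lambda>p. f1 (complex_of_real_pair p)) {p. complex_of_real_pair p \<in> D} (\<rho> z0)"
    using assms(4) \<open>z0 \<in> D\<close> by (auto simp: real_nash_on_def \<rho>)
  then obtain U P where U: "open U" "\<rho> z0 \<in> U" "U \<subseteq> {p. complex_of_real_pair p \<in> D}"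
    and P: "P \<noteq> 0"
      "\<And>p. p \<in> U \<Longrightarrow> poly_eval P (case_option (f1 (complex_of_real_pair p)) (\<lambda>k. p $ k)) = 0"
    unfolding nash_at_def by blast
  have "open (\<rho> -` U)"
    unfolding \<rho>_def using U continuous_on_real_pair_of_complex by (intro open_vimage) auto
  then obtain r where r: "r > 0" "ball z0 r \<subseteq> \<rho> -` U"
    using U(2) openE[of "\<rho> -` U" z0] by auto
  have rD: "ball z0 r \<subseteq> D"
    using r U(3) \<rho> by force
  have hol: "several_holomorphic_on f (ball z0 r)"
    using assms(3) rD unfolding several_holomorphic_on_def by blast
  have zero: "poly_eval P (case_option (Re (f z)) (case_sum (\<lambda>j. Re (z $ j)) (\<lambda>j. Im (z $ j)))) = 0"
    if "z \<in> ball z0 r" for z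
  proof -
    have "\<rho> z \<in> U" "z \<in> D" using that r rD by auto
    from P(2)[OF this(1)] show ?thesis
      unfolding \<rho> using assms(2)[OF \<open>z \<in> D\<close>] by (simp add: \<rho>_def)
  qed

  \<comment> \<open>The ball is pulled back to real coordinates and shrunk to an open box, the
    product shape that the grid lemma requires.\<close>
  have "open (complex_of_real_pair -` ball z0 r)"
    using continuous_on_complex_of_real_pair by (intro open_vimage) auto
  then obtain I where I: "\<And>k. open (I k)" "\<And>k. \<rho> z0 $ k \<in> I k"
    "\<And>p. (\<And>k. p $ k \<in> I k) \<Longrightarrow> complex_of_real_pair p \<in> ball z0 r"
    using r \<rho>[of z0] unfolding open_vec_def
    by (metis (no_types, lifting) centre_in_ball vimage_eq)
  \<comment> \<open>Each side of the box is open and nonempty, hence infinite; the coordinate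
    \<open>t\<close> ranges over the whole line, so \<open>x None\<close> need not be related to
    \<open>f w\<close>.\<close>
  have "infinite (case_option UNIV I v)" for v
    using I(1,2) finite_imp_not_open by (cases v) (auto simp: infinite_UNIV_char_0)
  then obtain x where x: "\<And>v. x v \<in> case_option UNIV I v" "poly_eval P x \<noteq> 0"
    using poly_eval_nonzero_on_grid[OF P(1)] by metis
  define w where "w = complex_of_real_pair (\<chi> k. x (Some k))"
  have w: "w \<in> ball z0 r"
    unfolding w_def using x(1)[of "Some _"] by (intro I(3)) auto
  have xw: "case_option (x None) (case_sum (\<lambda>j. Re (w $ j)) (\<lambda>j. Im (w $ j))) = x"
    by (auto simp: w_def complex_of_real_pair_def fun_eq_iff split: option.split sum.split)

  \<comment> \<open>With \<open>w\<close> frozen, its conjugate and that of \<open>f w\<close> are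
    constants, and \<open>g\<close> is polynomial in \<open>t\<close> and \<open>z\<close>
    jointly.\<close>
  define c where "c = cnj (f w)"
  define g where "g t z = poly_eval (complexify P) (polarized_point ((t + c) / 2) z w)" for t z
  have "polynomial_fun (\<lambda>y :: 'n option \<Rightarrow> complex. g (y None) (\<chi> j. y (Some j)))"
    unfolding g_def
  proof (rule polynomial_fun_poly_eval)
    fix v
    show "polynomial_fun (\<lambda>y. polarized_point ((y None + c) / 2) (\<chi> j. y (Some j)) w v)"
    proof (cases v)
      case None
      then show ?thesis
        by (simp add: polarized_point_def polynomial_fun_affine)
    next
      case (Some k)
      then show ?thesis
        using polynomial_fun_affine[of _ "- cnj (w $ _)" "2 * \<i>"]
        by (cases k) (simp_all add: polarized_point_def polynomial_fun_affine)
    qed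
  qed
  then obtain Q where Q: "\<And>y. poly_eval Q y = g (y None) (\<chi> j. y (Some j))"
    unfolding polynomial_fun_def by blast
  then have Q': "poly_eval Q (case_option t (\<lambda>j. z $ j)) = g t z" for t z
    by simp
  \<comment> \<open>This \<open>t\<close> solves \<open>(t + c) / 2 = x None\<close>, so at
    \<open>z = w\<close> the polarized point is the real point \<open>x\<close>, where
    \<open>P\<close> does not vanish.\<close>
  have "g (2 * of_real (x None) - c) w \<noteq> 0"
    using x(2) by (simp add: g_def polarized_point_diagonal poly_eval_complexify_of_real xw)
  then have "Q \<noteq> 0"
    using Q' poly_eval_zero by metis
  moreover have "poly_eval Q (case_option (f z) (\<lambda>j. z $ j)) = 0" if "z \<in> ball z0 r" for z
    unfolding Q' g_def c_def using polarization[OF hol zero that w] by simp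
  ultimately show "nash_at several_holomorphic_on f D z0"
    unfolding nash_at_def using r rD hol by (intro exI[of _ "ball z0 r"] exI[of _ Q]) auto
qed

end
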